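(* Let $(K,\Sigma)$ be a tight FFCC pair for $\mathbf H$, $J$ an R-ideal on $\omega$ and $\bar t=\langle t_n:n<\omega\rangle\in\mathrm{PC}^J_{\mathrm{w}\infty}(K,\Sigma)$. Suppose that $\bar D=\langle D_n:n<\omega\rangle\in\mathrm{suf}^J_{\bar t}$ satisfies $\bar D\circledast\bar D=\bar D$ and let $A_n\in D_n$ for $n<\omega$. Then there are $\bar s=\langle s_i:i<\omega\rangle\in\mathrm{PC}^J_{\mathrm{w}\infty}(K,\Sigma)$ and integers $0=k(0)<k(1)<k(2)<\dots<\omega$ such that $\bar t\le\bar s$, $m^{s_0}_{\mathrm{dn}}=m^{t_0}_{\mathrm{dn}}$, and for all $i<j<\omega$ and $\ell<\omega$: if $s_{k(i)}\in\Sigma^{\mathtt{tt}}(\bar t\upharpoonleft\ell)$ then $\mathrm{pos}(s_{k(i)},s_{k(i)+1},\dots,s_{k(j)-1})\subseteq A_\ell$.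
   Context: Notation: an integer $n$ is identified with $\{0,\dots,n-1\}$; $[n,m)=\{k\in\omega:n\le k<m\}$. Fix $\mathbf H$ with domain $\omega$, each $\mathbf H(i)$ finite non-empty; $\mathcal F_{\mathbf H}$ is the set of finite non-empty functions $f$ with $\mathrm{dom}(f)\subseteq\omega$, $f(i)\in\mathbf H(i)$. An FP creature for $\mathbf H$ is a tuple $t=(\mathrm{nor}[t],\mathrm{val}[t],\mathrm{dis}[t],m^t_{\mathrm{dn}},m^t_{\mathrm{up}})$ with $\mathrm{nor}[t]\ge0$ real, $\mathrm{dis}[t]$ arbitrary, $m^t_{\mathrm{dn}}<m^t_{\mathrm{up}}<\omega$, $\mathrm{val}[t]$ a non-empty finite subset of $\mathcal F_{\mathbf H}$ whose members have domains inside $[m^t_{\mathrm{dn}},m^t_{\mathrm{up}})$. A tight FFCC pair for $\mathbf H$ is a pair $(K,\Sigma)$ with: $K$ a countable family of FP creatures for $\mathbf H$; for each $m$, $\{t\in K:m^t_{\mathrm{up}}\le m\}$ finite and $\{t\in K:m^t_{\mathrm{dn}}\ge m,\ \mathrm{nor}[t]\ge m\}$ infinite; $\Sigma$ a function defined exactly on the finite sequences $(t_0,\dots,t_n)$ of members of $K$ with $m^{t_\ell}_{\mathrm{up}}=m^{t_{\ell+1}}_{\mathrm{dn}}$ ($\ell<n$), with values non-empty subsets of $K$; if $t\in\Sigma(t_0,\dots,t_n)$ then $m^t_{\mathrm{dn}}=m^{t_0}_{\mathrm{dn}}$, $m^t_{\mathrm{up}}=m^{t_n}_{\mathrm{up}}$,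 and every $f\in\mathrm{val}[t]$ has $\mathrm{dom}(f)\subseteq\bigcup_{\ell\le n}[m^{t_\ell}_{\mathrm{dn}},m^{t_\ell}_{\mathrm{up}})$ and $f\upharpoonright[m^{t_\ell}_{\mathrm{dn}},m^{t_\ell}_{\mathrm{up}})\in\mathrm{val}[t_\ell]$ for all $\ell\le n$; $t\in\Sigma(t)$ for $t\in K$; if $\bar t_0,\dots,\bar t_n\in\mathrm{dom}(\Sigma)$ and their concatenation $\bar t\in\mathrm{dom}(\Sigma)$ then $\Sigma(s_0,\dots,s_n)\subseteq\Sigma(\bar t)$ whenever $s_\ell\in\Sigma(\bar t_\ell)$; and if $s_0,s_1\in K$, $m^{s_0}_{\mathrm{up}}=m^{s_1}_{\mathrm{dn}}$, $f_0\in\mathrm{val}[s_0]$, $f_1\in\mathrm{val}[s_1]$, then $f_0\cup f_1\in\mathrm{val}[s]$ for some $s\in\Sigma(s_0,s_1)$. Outside $\mathrm{dom}(\Sigma)$ set $\Sigma(\cdot)=\emptyset$. An ideal on $\omega$ is a family $J$ of subsets of $\omega$ containing all finite sets, not containing $\omega$, closed under subsets and finite unions; $J^+=\mathcal P(\omega)\setminus J$, $J^c=\{\omega\setminus A:A\in J\}$. A $\limsup_J$-candidate is a sequence $\bar t=\langle t_n\rangle$ of members of $K$ with $m^{t_n}_{\mathrm{up}}=m^{t_{n+1}}_{\mathrm{dn}}$ for all $n$ such that for each $M$, $\{m^{t_n}_{\mathrm{dn}}:n<\omega,\ \mathrm{nor}[t_n]>M\}\in J^+$; $\mathrm{PC}^J_{\mathrm{w}\infty}(K,\Sigma)$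 is the set of these. A finite candidate is a finite sequence $\bar s=\langle s_n:n<N\rangle$ of members of $K$ with $m^{s_n}_{\mathrm{up}}=m^{s_{n+1}}_{\mathrm{dn}}$; $\mathrm{pos}(\bar s)=\bigcup\{\mathrm{val}[s]:s\in\Sigma(s_0,\dots,s_{N-1})\}$, $\mathrm{base}_M(\bar s)=\{m^{s_n}_{\mathrm{dn}}:n<N,\ \mathrm{nor}[s_n]\ge M\}$. For $\bar t\in\mathrm{PC}^J_{\mathrm{w}\infty}(K,\Sigma)$: $\bar t\upharpoonleft n=\langle t_{n+k}:k<\omega\rangle$; $\Sigma^{\mathtt{tt}}(\bar t)=\bigcup_n\Sigma(t_0,\dots,t_n)$; $\mathrm{pos}^{\mathtt{tt}}(\bar t)=\bigcup\{\mathrm{val}[s]:s\in\Sigma^{\mathtt{tt}}(\bar t)\}$; $\bar t\le\bar s$ means there are non-empty finite $u_n\subseteq\omega$ with $\max u_n<\min u_{n+1}$ and $s_n\in\Sigma(\bar t\upharpoonright u_n)$ ($\bar t\upharpoonright u$ = the tuple $(t_i:i\in u)$ increasingly); $\Sigma^{\mathrm{seq}}(\bar t)$ is the set of finite candidates $\bar s=\langle s_n:n<N\rangle$ with $m^{s_0}_{\mathrm{dn}}=m^{t_0}_{\mathrm{dn}}$ and each $s_n\in\Sigma(t_k,\dots,t_{\ell-1})$ for some $k<\ell$. For $f\in\mathrm{pos}^{\mathtt{tt}}(\bar t\upharpoonleft n)$, $x_f$ is the unique $m>n$ with $f\in\mathrm{val}[s]$ for some $s\in\Sigma(t_n,\dots,t_{m-1})$;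 $f\circledast A=\{g\in\mathrm{pos}^{\mathtt{tt}}(\bar t\upharpoonleft x_f):f\cup g\in A\}$. $\mathrm{suf}_{\bar t}$ is the set of sequences $\bar D=\langle D_n\rangle$ with each $D_n$ a non-principal ultrafilter on $\mathrm{pos}^{\mathtt{tt}}(\bar t\upharpoonleft n)$; $\mathrm{set}^n_{\bar t}(A,\bar D)=\{f\in\mathrm{pos}^{\mathtt{tt}}(\bar t\upharpoonleft n):f\circledast A\in D_{x_f}\}$; $\bar D^1\circledast\bar D^2=\langle D_n\rangle$ with $D_n=\{A\subseteq\mathrm{pos}^{\mathtt{tt}}(\bar t\upharpoonleft n):\mathrm{set}^n_{\bar t}(A,\bar D^1)\in D^2_n\}$. $\mathcal D^{n,J}_{\bar t}$ is the family of $B\subseteq\mathrm{pos}^{\mathtt{tt}}(\bar t\upharpoonleft n)$ for which there are $M<\omega$ and $Y\in J^c$ such that $B\cap\mathrm{pos}(\bar s)\ne\emptyset$ for every $\bar s\in\Sigma^{\mathrm{seq}}(\bar t\upharpoonleft n)$ with $\mathrm{base}_M(\bar s)\cap Y\ne\emptyset$. $\mathrm{suf}^J_{\bar t}$ is the set of $\bar D\in\mathrm{suf}_{\bar t}$ with $\mathcal D^{n,J}_{\bar t}\subseteq D_n$ for all $n$. The game $\Game_J$: in round $i$ player One chooses $Z_i\in J^+$, then Two chooses $k_i\in Z_i$; Two wins iff $\{k_i:i<\omega\}\in J^+$. $J$ is an R-ideal if One has no winning strategy in $\Game_J$. *)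

theory Defs
  imports Complex_Main "HOL-Library.Countable_Set"
begin

section \<open>FP creatures and tight FFCC pairs\<close>

text \<open>Finite partial functions are maps \<open>nat \<rightharpoonup> 'a\<close>. All unions \<open>f \<union> g\<close> below are formed for
  functions with disjoint domains, where they coincide with \<open>f ++ g\<close>.\<close>

definition FH :: "(nat \<Rightarrow> 'a set) \<Rightarrow> (nat \<rightharpoonup> 'a) set" where
  "FH H = {f. finite (dom f) \<and> dom f \<noteq> {} \<and> (\<forall>i\<in>dom f. the (f i) \<in> H i)}"

record ('a, 'd) creature =
  nor :: real
  val :: "(nat \<rightharpoonup> 'a) set"
  dis :: 'd
  mdn :: nat
  mup :: nat

definition FP_creature :: "(nat \<Rightarrow> 'a set) \<Rightarrow> ('a, 'd) creature \<Rightarrow> bool" where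
  "FP_creature H t \<longleftrightarrow>
     0 \<le> nor t \<and> mdn t < mup t \<and>
     finite (val t) \<and> val t \<noteq> {} \<and> val t \<subseteq> FH H \<and>
     (\<forall>f\<in>val t. dom f \<subseteq> {mdn t..<mup t})"

definition finite_candidate :: "('a, 'd) creature set \<Rightarrow> ('a, 'd) creature list \<Rightarrow> bool" where
  "finite_candidate K ss \<longleftrightarrow> set ss \<subseteq> K \<and> successively (\<lambda>s s'. mup s = mdn s') ss"

definition dom_Sigma :: "('a, 'd) creature set \<Rightarrow> ('a, 'd) creature list set" where
  "dom_Sigma K = {ts. ts \<noteq> [] \<and> finite_candidate K ts}"

text \<open>The operation \<open>\<Sigma>\<close> is a total function on lists that is empty outside its domain.\<close>

locale tight_FFCC_pair =
  fixes H :: "nat \<Rightarrow> 'a set"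
    and K :: "('a, 'd) creature set"
    and Sig :: "('a, 'd) creature list \<Rightarrow> ('a, 'd) creature set"
  assumes H_finite: "finite (H i)"
    and H_nonempty: "H i \<noteq> {}"
    and K_countable: "countable K"
    and K_creatures: "t \<in> K \<Longrightarrow> FP_creature H t"
    and K_below_finite: "finite {t \<in> K. mup t \<le> m}"
    and K_above_infinite: "infinite {t \<in> K. m \<le> mdn t \<and> real m \<le> nor t}"
    and Sig_outside: "ts \<notin> dom_Sigma K \<Longrightarrow> Sig ts = {}"
    and Sig_nonempty: "ts \<in> dom_Sigma K \<Longrightarrow> Sig ts \<noteq> {}"
    and Sig_subset: "ts \<in> dom_Sigma K \<Longrightarrow> Sig ts \<subseteq> K"
    and Sig_mdn: "ts \<in> dom_Sigma K \<Longrightarrow> t \<in> Sig ts \<Longrightarrow> mdn t = mdn (hd ts)"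
    and Sig_mup: "ts \<in> dom_Sigma K \<Longrightarrow> t \<in> Sig ts \<Longrightarrow> mup t = mup (last ts)"
    and Sig_val_dom: "ts \<in> dom_Sigma K \<Longrightarrow> t \<in> Sig ts \<Longrightarrow> f \<in> val t \<Longrightarrow>
           dom f \<subseteq> (\<Union>r\<in>set ts. {mdn r..<mup r})"
    and Sig_val_restrict: "ts \<in> dom_Sigma K \<Longrightarrow> t \<in> Sig ts \<Longrightarrow> f \<in> val t \<Longrightarrow> r \<in> set ts \<Longrightarrow>
           f |` {mdn r..<mup r} \<in> val r"
    and Sig_refl: "t \<in> K \<Longrightarrow> t \<in> Sig [t]"
    and Sig_trans: "set tss \<subseteq> dom_Sigma K \<Longrightarrow> concat tss \<in> dom_Sigma K \<Longrightarrow>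
           list_all2 (\<lambda>s ts. s \<in> Sig ts) ss tss \<Longrightarrow> Sig ss \<subseteq> Sig (concat tss)"
    and Sig_amalgamation: "s0 \<in> K \<Longrightarrow> s1 \<in> K \<Longrightarrow> mup s0 = mdn s1 \<Longrightarrow>
           f0 \<in> val s0 \<Longrightarrow> f1 \<in> val s1 \<Longrightarrow> \<exists>s\<in>Sig [s0, s1]. f0 ++ f1 \<in> val s"

section \<open>Ideals on the natural numbers and the game\<close>

definition ideal_on_nat :: "nat set set \<Rightarrow> bool" where
  "ideal_on_nat J \<longleftrightarrow>
     (\<forall>X. finite X \<longrightarrow> X \<in> J) \<and> UNIV \<notin> J \<and>
     (\<forall>X Y. X \<in> J \<longrightarrow> Y \<subseteq> X \<longrightarrow> Y \<in> J) \<and>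
     (\<forall>X Y. X \<in> J \<longrightarrow> Y \<in> J \<longrightarrow> X \<union> Y \<in> J)"

definition J_plus :: "nat set set \<Rightarrow> nat set set" where
  "J_plus J = - J"

definition J_co :: "nat set set \<Rightarrow> nat set set" where
  "J_co J = {- X | X. X \<in> J}"

text \<open>A strategy of One maps each history of completed rounds \<open>(Z\<^sub>j, k\<^sub>j)\<close> to his next move.\<close>

definition strategy_One :: "nat set set \<Rightarrow> ((nat set \<times> nat) list \<Rightarrow> nat set) \<Rightarrow> bool" where
  "strategy_One J \<sigma> \<longleftrightarrow> (\<forall>h. \<sigma> h \<in> J_plus J)"

definition play_following :: "((nat set \<times> nat) list \<Rightarrow> nat set) \<Rightarrow> (nat \<Rightarrow> nat set) \<Rightarrow> (nat \<Rightarrow> nat) \<Rightarrow> bool" where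
  "play_following \<sigma> Z k \<longleftrightarrow>
     (\<forall>i. Z i = \<sigma> (map (\<lambda>j. (Z j, k j)) [0..<i]) \<and> k i \<in> Z i)"

definition winning_strategy_One :: "nat set set \<Rightarrow> ((nat set \<times> nat) list \<Rightarrow> nat set) \<Rightarrow> bool" where
  "winning_strategy_One J \<sigma> \<longleftrightarrow>
     strategy_One J \<sigma> \<and> (\<forall>Z k. play_following \<sigma> Z k \<longrightarrow> range k \<notin> J_plus J)"

definition R_ideal :: "nat set set \<Rightarrow> bool" where
  "R_ideal J \<longleftrightarrow> ideal_on_nat J \<and> \<not> (\<exists>\<sigma>. winning_strategy_One J \<sigma>)"

section \<open>Candidates and possibilities\<close>

definition PC_winf :: "nat set set \<Rightarrow> ('a, 'd) creature set \<Rightarrow> (nat \<Rightarrow> ('a, 'd) creature) set" where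
  "PC_winf J K =
     {t. (\<forall>n. t n \<in> K) \<and> (\<forall>n. mup (t n) = mdn (t (Suc n))) \<and>
         (\<forall>M::nat. {mdn (t n) | n. nor (t n) > real M} \<in> J_plus J)}"

context
  fixes Sig :: "('a, 'd) creature list \<Rightarrow> ('a, 'd) creature set"
begin

definition pos :: "('a, 'd) creature list \<Rightarrow> (nat \<rightharpoonup> 'a) set" where
  "pos ss = (\<Union>s\<in>Sig ss. val s)"

definition Sigma_tt :: "(nat \<Rightarrow> ('a, 'd) creature) \<Rightarrow> ('a, 'd) creature set" where
  "Sigma_tt t = (\<Union>n. Sig (map t [0..<Suc n]))"

definition pos_tt :: "(nat \<Rightarrow> ('a, 'd) creature) \<Rightarrow> (nat \<rightharpoonup> 'a) set" where
  "pos_tt t = (\<Union>s\<in>Sigma_tt t. val s)"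

definition cand_le :: "(nat \<Rightarrow> ('a, 'd) creature) \<Rightarrow> (nat \<Rightarrow> ('a, 'd) creature) \<Rightarrow> bool" where
  "cand_le t s \<longleftrightarrow>
     (\<exists>u :: nat \<Rightarrow> nat set. \<forall>n. finite (u n) \<and> u n \<noteq> {} \<and> Max (u n) < Min (u (Suc n)) \<and>
        s n \<in> Sig (map t (sorted_list_of_set (u n))))"

definition Sigma_seq :: "('a, 'd) creature set \<Rightarrow> (nat \<Rightarrow> ('a, 'd) creature) \<Rightarrow> ('a, 'd) creature list set" where
  "Sigma_seq K t =
     {ss. finite_candidate K ss \<and> ss \<noteq> [] \<and> mdn (hd ss) = mdn (t 0) \<and>
          (\<forall>s\<in>set ss. \<exists>k l. k < l \<and> s \<in> Sig (map t [k..<l]))}"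

end

definition base :: "nat \<Rightarrow> ('a, 'd) creature list \<Rightarrow> nat set" where
  "base M ss = {mdn s | s. s \<in> set ss \<and> nor s \<ge> real M}"

definition tail_seq :: "(nat \<Rightarrow> 'c) \<Rightarrow> nat \<Rightarrow> nat \<Rightarrow> 'c" where
  "tail_seq t n = (\<lambda>k. t (n + k))"

section \<open>Ultrafilters on possibilities\<close>

definition ultrafilter_on :: "'c set \<Rightarrow> 'c set set \<Rightarrow> bool" where
  "ultrafilter_on S U \<longleftrightarrow>
     U \<subseteq> Pow S \<and> S \<in> U \<and> {} \<notin> U \<and>
     (\<forall>A B. A \<in> U \<longrightarrow> A \<subseteq> B \<longrightarrow> B \<subseteq> S \<longrightarrow> B \<in> U) \<and>
     (\<forall>A B. A \<in> U \<longrightarrow> B \<in> U \<longrightarrow> A \<inter> B \<in> U) \<and>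
     (\<forall>A. A \<subseteq> S \<longrightarrow> A \<in> U \<or> S - A \<in> U)"

definition nonprincipal_ultrafilter_on :: "'c set \<Rightarrow> 'c set set \<Rightarrow> bool" where
  "nonprincipal_ultrafilter_on S U \<longleftrightarrow>
     ultrafilter_on S U \<and> \<not> (\<exists>x\<in>S. U = {A. A \<subseteq> S \<and> x \<in> A})"

context
  fixes Sig :: "('a, 'd) creature list \<Rightarrow> ('a, 'd) creature set"
    and t :: "nat \<Rightarrow> ('a, 'd) creature"
begin

text \<open>In \<open>x_of n f\<close> and \<open>circ n f A\<close> the index \<open>n\<close>, for which \<open>f \<in> pos_tt (tail_seq t n)\<close>, is explicit.\<close>

definition x_of :: "nat \<Rightarrow> (nat \<rightharpoonup> 'a) \<Rightarrow> nat" where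
  "x_of n f = (THE m. m > n \<and> (\<exists>s\<in>Sig (map t [n..<m]). f \<in> val s))"

definition circ :: "nat \<Rightarrow> (nat \<rightharpoonup> 'a) \<Rightarrow> (nat \<rightharpoonup> 'a) set \<Rightarrow> (nat \<rightharpoonup> 'a) set" where
  "circ n f A = {g \<in> pos_tt Sig (tail_seq t (x_of n f)). f ++ g \<in> A}"

definition suf :: "(nat \<Rightarrow> (nat \<rightharpoonup> 'a) set set) set" where
  "suf = {D. \<forall>n. nonprincipal_ultrafilter_on (pos_tt Sig (tail_seq t n)) (D n)}"

definition set_n :: "nat \<Rightarrow> (nat \<rightharpoonup> 'a) set \<Rightarrow> (nat \<Rightarrow> (nat \<rightharpoonup> 'a) set set) \<Rightarrow> (nat \<rightharpoonup> 'a) set" where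
  "set_n n A D = {f \<in> pos_tt Sig (tail_seq t n). circ n f A \<in> D (x_of n f)}"

definition suf_prod :: "(nat \<Rightarrow> (nat \<rightharpoonup> 'a) set set) \<Rightarrow> (nat \<Rightarrow> (nat \<rightharpoonup> 'a) set set) \<Rightarrow>
    nat \<Rightarrow> (nat \<rightharpoonup> 'a) set set" where
  "suf_prod D1 D2 = (\<lambda>n. {A. A \<subseteq> pos_tt Sig (tail_seq t n) \<and> set_n n A D1 \<in> D2 n})"

definition D_fam :: "('a, 'd) creature set \<Rightarrow> nat set set \<Rightarrow> nat \<Rightarrow> (nat \<rightharpoonup> 'a) set set" where
  "D_fam K J n =
     {B. B \<subseteq> pos_tt Sig (tail_seq t n) \<and>
         (\<exists>M. \<exists>Y\<in>J_co J. \<forall>ss\<in>Sigma_seq Sig K (tail_seq t n).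
            base M ss \<inter> Y \<noteq> {} \<longrightarrow> B \<inter> pos Sig ss \<noteq> {})}"

definition suf_J :: "('a, 'd) creature set \<Rightarrow> nat set set \<Rightarrow> (nat \<Rightarrow> (nat \<rightharpoonup> 'a) set set) set" where
  "suf_J K J = {D \<in> suf. \<forall>n. D_fam K J n \<subseteq> D n}"

end

end

theory Submission
  imports Defs
begin

text \<open>This is the Galvin--Glazer argument, played against the ideal game. Idempotence of \<open>D\<close> gives sets
  \<open>star n \<subseteq> A n\<close> in \<open>D n\<close> such that \<open>f \<circledast> star n \<in> D x\<^sub>f\<close> for every \<open>f \<in> star n\<close>. The sequence \<open>s\<close> is
  a concatenation of finite blocks: the possibilities of each new block must lie in the star set of
  its own starting index and in \<open>f \<circledast> star\<close> for each of the finitely many possibilities \<open>f\<close> of the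
  earlier blocks. These requirements define a member of \<open>D n\<close>, whose complement is therefore not in
  \<open>\<D>\<^sup>n\<^sup>J\<close>; hence the points at which some admissible block has norm at least \<open>i\<close> form a \<open>J\<close>-positive
  set. Playing this set in round \<open>i\<close> is not a winning strategy for One, so some play against it
  yields blocks whose large-norm points are \<open>J\<close>-positive.\<close>

section \<open>Ideals, the game and ultrafilters\<close>

lemma ideal_on_nat_finite: "ideal_on_nat J \<Longrightarrow> finite X \<Longrightarrow> X \<in> J"
  unfolding ideal_on_nat_def by blast

lemma ideal_on_nat_subset: "ideal_on_nat J \<Longrightarrow> X \<in> J \<Longrightarrow> Y \<subseteq> X \<Longrightarrow> Y \<in> J"
  unfolding ideal_on_nat_def by blast

lemma ideal_on_nat_Un: "ideal_on_nat J \<Longrightarrow> X \<in> J \<Longrightarrow> Y \<in> J \<Longrightarrow> X \<union> Y \<in> J"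
  unfolding ideal_on_nat_def by blast

text \<open>Transfers the game to moves that carry extra data \<open>b\<close>: One offers every
  number that some datum justifies, and the data are recovered from Two's answers by choice.\<close>

lemma R_ideal_play:
  assumes J: "R_ideal J"
    and move: "\<And>bs. \<forall>i<length bs. \<exists>k. ok (take i bs) (bs ! i) k \<Longrightarrow> {k. \<exists>b. ok bs b k} \<in> J_plus J"
  obtains b :: "nat \<Rightarrow> 'b" and k :: "nat \<Rightarrow> nat"
  where "\<And>i. ok (map b [0..<i]) (b i) (k i)" and "range k \<in> J_plus J"
proof -
  \<comment> \<open>A history of the game records only sets and numbers, so \<open>st\<close>
    replays it, choosing for each number a datum that fits the data chosen before.\<close>
  define st where "st = foldl (\<lambda>bs (zk :: nat set \<times> nat). bs @ [SOME b. ok bs b (snd zk)]) []"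
  \<comment> \<open>\<open>UNIV\<close> is a default: a strategy must make a positive move after
    every history, and no ideal contains \<open>UNIV\<close>.\<close>
  define \<sigma> where
    "\<sigma> h = (if {k. \<exists>b. ok (st h) b k} \<in> J_plus J then {k. \<exists>b. ok (st h) b k} else UNIV)" for h
  have "strategy_One J \<sigma>"
    using J by (auto simp: strategy_One_def \<sigma>_def R_ideal_def ideal_on_nat_def J_plus_def)
  with J obtain Z k where play: "play_following \<sigma> Z k" and k: "range k \<in> J_plus J"
    unfolding R_ideal_def winning_strategy_One_def by blast
  define h where "h i = map (\<lambda>j. (Z j, k j)) [0..<i]" for i
  define b where "b i = (SOME b. ok (st (h i)) b (k i))" for i
  have st: "st (h i) = map b [0..<i]" for i
  proof (induction i)
    case 0
    show ?case by (simp add: st_def h_def)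
  next
    case (Suc i)
    have "st (h (Suc i)) = st (h i) @ [b i]"
      by (simp add: st_def h_def b_def)
    with Suc show ?case by simp
  qed
  have ok: "ok (map b [0..<i]) (b i) (k i)" for i
  proof (induction i rule: less_induct)
    case (less i)
    have "{k. \<exists>b. ok (st (h i)) b k} \<in> J_plus J"
      unfolding st
    proof (rule move, intro allI impI)
      fix j assume "j < length (map b [0..<i])"
      then show "\<exists>k. ok (take j (map b [0..<i])) (map b [0..<i] ! j) k"
        using less[of j] by (auto simp: take_map)
    qed
    then have "\<sigma> (h i) = {k. \<exists>b. ok (st (h i)) b k}"
      by (simp add: \<sigma>_def)
    moreover have "k i \<in> \<sigma> (h i)"
      using play unfolding play_following_def h_def by metis
    ultimately have "\<exists>b. ok (st (h i)) b (k i)" by blast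
    then have "ok (st (h i)) (b i) (k i)"
      unfolding b_def by (rule someI_ex)
    then show ?case by (simp add: st)
  qed
  show ?thesis using that ok k by blast
qed

lemma map_upt_append: "a \<le> b \<Longrightarrow> b \<le> c \<Longrightarrow> map f [a..<b] @ map f [b..<c] = map f [a..<c]"
  by (metis le_Suc_ex map_append upt_add_eq_append)

lemma ultrafilter_on_Int: "ultrafilter_on S U \<Longrightarrow> X \<in> U \<Longrightarrow> Y \<in> U \<Longrightarrow> X \<inter> Y \<in> U"
  by (simp add: ultrafilter_on_def)

text \<open>The factor \<open>S\<close> settles the case of empty \<open>I\<close>, where the bare
  intersection is \<open>UNIV\<close>.\<close>

lemma ultrafilter_on_INT:
  assumes U: "ultrafilter_on S U" and "finite I" and "\<And>i. i \<in> I \<Longrightarrow> F i \<in> U"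
  shows "S \<inter> (\<Inter>i\<in>I. F i) \<in> U"
  using assms(2,3)
proof (induction I)
  case empty
  then show ?case using U by (simp add: ultrafilter_on_def)
next
  case (insert i I)
  have "F i \<inter> (S \<inter> (\<Inter>i\<in>I. F i)) \<in> U"
    using insert by (intro ultrafilter_on_Int[OF U, of "F i"]) auto
  then show ?case by (simp add: ac_simps)
qed

section \<open>Cutting and joining possibilities\<close>

context tight_FFCC_pair
begin

lemma dom_Sigma_in_K: "ts \<in> dom_Sigma K \<Longrightarrow> set ts \<subseteq> K"
  by (simp add: dom_Sigma_def finite_candidate_def)

lemma dom_SigmaI: "s \<in> Sig ts \<Longrightarrow> ts \<in> dom_Sigma K"
  using Sig_outside by blast

text \<open>All members of \<open>Sig ss\<close> end at \<open>mup (last ss)\<close>, so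
  \<open>K_below_finite\<close> leaves finitely many, each with finite \<open>val\<close>. This
  keeps the number of conditions on a new block finite.\<close>

lemma finite_pos: "finite (pos Sig ss)"
proof (cases "ss \<in> dom_Sigma K")
  case True
  then have sub: "Sig ss \<subseteq> {t \<in> K. mup t \<le> mup (last ss)}"
    using Sig_subset Sig_mup by fastforce
  then have "finite (Sig ss)"
    using K_below_finite finite_subset by blast
  with sub K_creatures show ?thesis
    unfolding pos_def FP_creature_def by blast
next
  case False
  then show ?thesis by (simp add: pos_def Sig_outside)
qed

text \<open>A converse to \<open>Sig_val_restrict\<close>: amalgamation glues the piece at the head
  to a possibility of the rest, and \<open>Sig_trans\<close> moves the result to the whole
  list.\<close>

lemma restrict_in_pos:
  assumes "ss \<in> dom_Sigma K" and "\<And>r. r \<in> set ss \<Longrightarrow> f |` {mdn r..<mup r} \<in> val r"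
  shows "f |` (\<Union>r\<in>set ss. {mdn r..<mup r}) \<in> pos Sig ss"
  using assms
proof (induction ss)
  case Nil
  then show ?case by (simp add: dom_Sigma_def)
next
  case (Cons r ss)
  have r: "r \<in> K" using Cons.prems(1) dom_Sigma_in_K by fastforce
  show ?case
  proof (cases "ss = []")
    case True
    then show ?thesis using Cons.prems(2)[of r] Sig_refl[OF r] by (auto simp: pos_def)
  next
    case False
    then have ss: "ss \<in> dom_Sigma K" and link: "mup r = mdn (hd ss)"
      using Cons.prems(1) by (cases ss; simp add: dom_Sigma_def finite_candidate_def)+
    let ?g = "f |` (\<Union>r\<in>set ss. {mdn r..<mup r})"
    obtain s where s: "s \<in> Sig ss" "?g \<in> val s"
      using Cons.IH[OF ss] Cons.prems(2) by (auto simp: pos_def)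
    have "s \<in> K" and "mdn s = mdn (hd ss)"
      using s ss Sig_subset Sig_mdn by blast+
    then obtain s' where s': "s' \<in> Sig [r, s]" "f |` {mdn r..<mup r} ++ ?g \<in> val s'"
      using Sig_amalgamation[OF r _ _ _ s(2)] link Cons.prems(2)[of r] by fastforce
    have "[r] \<in> dom_Sigma K" using r Sig_refl dom_SigmaI by blast
    then have "Sig [r, s] \<subseteq> Sig (concat [[r], ss])"
      using Cons.prems(1) ss s Sig_refl[OF r] by (intro Sig_trans) auto
    moreover have "f |` {mdn r..<mup r} ++ ?g = f |` (\<Union>r\<in>set (r # ss). {mdn r..<mup r})"
      by (rule ext) (auto simp: map_add_def restrict_map_def split: option.split)
    ultimately show ?thesis using s' by (auto simp: pos_def)
  qed
qed

text \<open>The halves are the restrictions of \<open>f\<close> to the intervals of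
  \<open>xs\<close> and of \<open>ys\<close>, which cover \<open>dom f\<close> by
  \<open>Sig_val_dom\<close>.\<close>

lemma pos_append_split:
  assumes xs: "xs \<in> dom_Sigma K" and ys: "ys \<in> dom_Sigma K" and f: "f \<in> pos Sig (xs @ ys)"
  obtains f0 f1 where "f0 \<in> pos Sig xs" "f1 \<in> pos Sig ys" "f = f0 ++ f1"
proof -
  obtain s where s: "s \<in> Sig (xs @ ys)" "f \<in> val s"
    using f by (auto simp: pos_def)
  note dom = dom_SigmaI[OF s(1)]
  let ?R = "\<lambda>ss. \<Union>r\<in>set ss. {mdn r..<mup r}"
  have "f |` ?R xs \<in> pos Sig xs" "f |` ?R ys \<in> pos Sig ys"
    using restrict_in_pos xs ys Sig_val_restrict[OF dom s] by auto
  moreover have "dom f \<subseteq> ?R xs \<union> ?R ys"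
    using Sig_val_dom[OF dom s] by auto
  then have "f x = (f |` ?R xs ++ f |` ?R ys) x" for x
    by (cases "f x") (fastforce simp: map_add_def restrict_map_def split: option.split)+
  then have "f = f |` ?R xs ++ f |` ?R ys" by blast
  ultimately show ?thesis using that by blast
qed

lemma pos_append:
  assumes "f0 \<in> pos Sig xs" "f1 \<in> pos Sig ys" "mup (last xs) = mdn (hd ys)"
    and "xs @ ys \<in> dom_Sigma K"
  shows "f0 ++ f1 \<in> pos Sig (xs @ ys)"
proof -
  obtain s0 s1 where s: "s0 \<in> Sig xs" "f0 \<in> val s0" "s1 \<in> Sig ys" "f1 \<in> val s1"
    using assms(1,2) by (auto simp: pos_def)
  have dom: "xs \<in> dom_Sigma K" "ys \<in> dom_Sigma K"
    using s dom_SigmaI by blast+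
  have "s0 \<in> K" "s1 \<in> K" "mup s0 = mdn s1"
    using s dom Sig_subset Sig_mup Sig_mdn assms(3) by auto
  then obtain s where "s \<in> Sig [s0, s1]" "f0 ++ f1 \<in> val s"
    using Sig_amalgamation s by blast
  moreover have "Sig [s0, s1] \<subseteq> Sig (concat [xs, ys])"
    using s dom assms(4) by (intro Sig_trans) auto
  ultimately show ?thesis by (auto simp: pos_def)
qed

end

section \<open>Segments of a fixed candidate and their possibilities\<close>

locale FFCC_candidate = tight_FFCC_pair H K Sig
  for H :: "nat \<Rightarrow> 'a set" and K :: "('a, 'd) creature set" and Sig +
  fixes t :: "nat \<Rightarrow> ('a, 'd) creature"
  assumes t_in_K: "t n \<in> K" and t_link: "mup (t n) = mdn (t (Suc n))"
begin

lemma strict_mono_mdn: "strict_mono (\<lambda>n. mdn (t n))"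
  using K_creatures[OF t_in_K] t_link by (auto simp: strict_mono_Suc_iff FP_creature_def)

lemma mdn_t_eq_iff [simp]: "mdn (t m) = mdn (t n) \<longleftrightarrow> m = n"
  using strict_mono_eq[OF strict_mono_mdn] by simp

lemma segment_dom: "a < b \<Longrightarrow> map t [a..<b] \<in> dom_Sigma K"
  using t_in_K t_link
  by (auto simp: dom_Sigma_def finite_candidate_def successively_conv_nth)

lemma segment_lt: "s \<in> Sig (map t [a..<b]) \<Longrightarrow> a < b"
  using dom_SigmaI by (fastforce simp: dom_Sigma_def)

lemma segment_mdn: "s \<in> Sig (map t [a..<b]) \<Longrightarrow> mdn s = mdn (t a)"
  using Sig_mdn[OF dom_SigmaI] segment_lt by (fastforce simp: hd_map)

lemma segment_mup: "s \<in> Sig (map t [a..<b]) \<Longrightarrow> mup s = mdn (t b)"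
proof -
  assume s: "s \<in> Sig (map t [a..<b])"
  have "a < b" using segment_lt[OF s] .
  then have "mup s = mup (t (b - 1))"
    using Sig_mup[OF dom_SigmaI s] s by (simp add: last_map)
  with \<open>a < b\<close> show ?thesis using t_link[of "b - 1"] by simp
qed

lemma map_tail_seq: "map (tail_seq t n) [a..<b] = map t [n + a..<n + b]"
  by (rule nth_equalityI) (auto simp: tail_seq_def ac_simps)

lemma pos_tt_tail: "pos_tt Sig (tail_seq t n) = (\<Union>m. pos Sig (map t [n..<m]))"
proof -
  have "(\<Union>k. pos Sig (map t [n..<Suc (n + k)])) = (\<Union>m. pos Sig (map t [n..<m]))" (is "?L = ?R")
  proof
    show "?R \<subseteq> ?L"
    proof
      fix f assume "f \<in> ?R"
      then obtain m where m: "f \<in> pos Sig (map t [n..<m])" by blast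
      then have "n < m" using segment_lt by (auto simp: pos_def)
      then have "m = Suc (n + (m - n - 1))" by simp
      then show "f \<in> ?L" using m by (metis UN_I UNIV_I)
    qed
  qed blast
  moreover have "pos_tt Sig (tail_seq t n) = (\<Union>k. pos Sig (map t [n..<Suc (n + k)]))"
    using map_tail_seq[of n 0] by (auto simp: pos_tt_def Sigma_tt_def pos_def simp del: upt_Suc)
  ultimately show ?thesis by simp
qed

text \<open>Yields the uniqueness behind \<open>x_of\<close>. If \<open>m' < m\<close>, then
  \<open>f\<close> has a point in the interval of \<open>t (m - 1)\<close>, since members of
  \<open>val\<close> are non-empty functions, yet the shorter segment ends at or below the start of
  that interval.\<close>

lemma pos_segment_le:
  assumes "f \<in> pos Sig (map t [n..<m])" "f \<in> pos Sig (map t [n..<m'])"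
  shows "m \<le> m'"
proof (rule ccontr)
  assume "\<not> m \<le> m'"
  obtain s s' where s: "s \<in> Sig (map t [n..<m])" "f \<in> val s"
    and s': "s' \<in> Sig (map t [n..<m'])" "f \<in> val s'"
    using assms by (auto simp: pos_def)
  have "t (m - 1) \<in> set (map t [n..<m])"
    using segment_lt[OF s(1)] by auto
  from Sig_val_restrict[OF dom_SigmaI[OF s(1)] s this]
  have "dom (f |` {mdn (t (m - 1))..<mup (t (m - 1))}) \<noteq> {}"
    using K_creatures[OF t_in_K] unfolding FP_creature_def FH_def by blast
  then obtain x where x: "x \<in> dom f" "mdn (t (m - 1)) \<le> x"
    by (auto simp: dom_def restrict_map_def split: if_splits)
  then obtain r where r: "r < m'" "x < mup (t r)"
    using Sig_val_dom[OF dom_SigmaI[OF s'(1)] s'] by fastforce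
  then have "mdn (t (Suc r)) \<le> mdn (t (m - 1))"
    using \<open>\<not> m \<le> m'\<close> by (intro strict_mono_leD[OF strict_mono_mdn]) auto
  with r x t_link[of r] show False by simp
qed

lemma x_of_eq:
  assumes "f \<in> pos Sig (map t [n..<m])"
  shows "x_of Sig t n f = m"
  unfolding x_of_def
proof (rule the_equality)
  show "m > n \<and> (\<exists>s\<in>Sig (map t [n..<m]). f \<in> val s)"
    using assms segment_lt by (auto simp: pos_def)
  fix m' assume "m' > n \<and> (\<exists>s\<in>Sig (map t [n..<m']). f \<in> val s)"
  then have "f \<in> pos Sig (map t [n..<m'])" by (auto simp: pos_def)
  with assms show "m' = m" by (intro le_antisym pos_segment_le)
qed

lemma pos_segment_append:
  assumes f: "f \<in> pos Sig (map t [n..<m])" and g: "g \<in> pos Sig (map t [m..<p])"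
  shows "f ++ g \<in> pos Sig (map t [n..<p])"
proof -
  have lt: "n < m" "m < p" using f g segment_lt by (auto simp: pos_def)
  then have seg: "map t [n..<m] @ map t [m..<p] = map t [n..<p]"
    by (simp add: map_upt_append)
  have "mup (t (m - 1)) = mdn (t m)" using t_link[of "m - 1"] lt by simp
  then show ?thesis
    using pos_append[OF f g] segment_dom[of n p] lt seg by (simp add: last_map hd_map)
qed

section \<open>Finite candidates built from consecutive segments\<close>

fun chain :: "nat \<Rightarrow> ('a, 'd) creature list \<Rightarrow> nat \<Rightarrow> bool" where
  "chain a [] b \<longleftrightarrow> a = b"
| "chain a (s # ss) b \<longleftrightarrow> (\<exists>c. s \<in> Sig (map t [a..<c]) \<and> chain c ss b)"

lemma chain_append: "chain a (xs @ ys) c \<longleftrightarrow> (\<exists>b. chain a xs b \<and> chain b ys c)"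
  by (induction xs arbitrary: a) auto

lemma chain_le: "chain a ss b \<Longrightarrow> a \<le> b"
  using segment_lt by (induction ss arbitrary: a) (auto, fastforce)

lemma chain_in_segments:
  "chain a ss b \<Longrightarrow> s \<in> set ss \<Longrightarrow> \<exists>a b. s \<in> Sig (map t [a..<b])"
  by (induction ss arbitrary: a) auto

lemma chain_mdn_hd: "chain a ss b \<Longrightarrow> ss \<noteq> [] \<Longrightarrow> mdn (hd ss) = mdn (t a)"
  using segment_mdn by (cases ss) auto

lemma chain_finite_candidate: "chain a ss b \<Longrightarrow> finite_candidate K ss"
proof (induction ss arbitrary: a)
  case Nil
  then show ?case by (simp add: finite_candidate_def)
next
  case (Cons s ss)
  then obtain c where c: "s \<in> Sig (map t [a..<c])" "chain c ss b" by auto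
  have "s \<in> K" using c dom_SigmaI Sig_subset by blast
  moreover have "ss \<noteq> [] \<Longrightarrow> mup s = mdn (hd ss)"
    using c segment_mup chain_mdn_hd by simp
  ultimately show ?case
    using Cons.IH[OF c(2)] by (auto simp: finite_candidate_def successively_Cons)
qed

lemma chain_dom: "chain a ss b \<Longrightarrow> ss \<noteq> [] \<Longrightarrow> ss \<in> dom_Sigma K"
  by (simp add: dom_Sigma_def chain_finite_candidate)

text \<open>The segments behind the entries, collected in \<open>tss\<close>, concatenate to
  \<open>map t [a..<b]\<close>, so \<open>Sig_trans\<close> applies.\<close>

lemma chain_pos_subset:
  assumes "chain a ss b" "ss \<noteq> []"
  shows "pos Sig ss \<subseteq> pos Sig (map t [a..<b])"
proof -
  have "\<exists>tss. set tss \<subseteq> dom_Sigma K \<and> concat tss = map t [a..<b] \<and>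
      list_all2 (\<lambda>s ts. s \<in> Sig ts) ss tss" if "chain a ss b" for a ss
    using that
  proof (induction ss arbitrary: a)
    case Nil
    then show ?case by (intro exI[of _ "[]"]) auto
  next
    case (Cons s ss)
    then obtain c where c: "s \<in> Sig (map t [a..<c])" "chain c ss b" by auto
    then obtain tss where "set tss \<subseteq> dom_Sigma K" "concat tss = map t [c..<b]"
      "list_all2 (\<lambda>s ts. s \<in> Sig ts) ss tss"
      using Cons.IH by blast
    moreover have "map t [a..<c] @ map t [c..<b] = map t [a..<b]"
      using segment_lt[OF c(1)] chain_le[OF c(2)]
      by (simp add: map_upt_append)
    ultimately show ?case
      using c dom_SigmaI[OF c(1)] by (intro exI[of _ "map t [a..<c] # tss"]) auto
  qed
  then obtain tss where tss: "set tss \<subseteq> dom_Sigma K" "concat tss = map t [a..<b]"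
      "list_all2 (\<lambda>s ts. s \<in> Sig ts) ss tss"
    using assms(1) by blast
  moreover have "a < b"
    using assms segment_lt chain_le by (cases ss) (auto, fastforce)
  ultimately have "Sig ss \<subseteq> Sig (map t [a..<b])"
    using Sig_trans[OF tss(1) _ tss(3)] segment_dom by simp
  then show ?thesis by (auto simp: pos_def)
qed

text \<open>\<open>Sigma_seq\<close> gives each entry a segment of its own; the links between
  \<open>mup\<close> and \<open>mdn\<close>, with injectivity of \<open>mdn\<close> along
  \<open>t\<close>, force each segment to begin where the previous one ends.\<close>

lemma Sigma_seq_chain:
  assumes "ss \<in> Sigma_seq Sig K (tail_seq t n)"
  shows "\<exists>b. chain n ss b"
proof -
  have "\<exists>b. chain n ss b"
    if "finite_candidate K ss" "ss \<noteq> [] \<longrightarrow> mdn (hd ss) = mdn (t n)"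
      "\<forall>s\<in>set ss. \<exists>a b. s \<in> Sig (map t [a..<b])" for ss n
    using that
  proof (induction ss arbitrary: n)
    case Nil
    then show ?case by simp
  next
    case (Cons s ss)
    then obtain a c where s: "s \<in> Sig (map t [a..<c])" by auto
    then have "a = n" using segment_mdn[OF s] Cons.prems(2) by simp
    have "\<exists>b. chain c ss b"
      using Cons.prems segment_mup[OF s]
      by (intro Cons.IH) (auto simp: finite_candidate_def successively_Cons)
    with s \<open>a = n\<close> show ?case by auto
  qed
  moreover have "\<forall>s\<in>set ss. \<exists>a b. s \<in> Sig (map t [a..<b])"
    using assms unfolding Sigma_seq_def map_tail_seq by blast
  ultimately show ?thesis
    using assms by (auto simp: Sigma_seq_def tail_seq_def)
qed

end

section \<open>Idempotent sequences of ultrafilters\<close>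

locale FFCC_idempotent = FFCC_candidate H K Sig t
  for H :: "nat \<Rightarrow> 'a set" and K :: "('a, 'd) creature set" and Sig t +
  fixes J and D :: "nat \<Rightarrow> (nat \<rightharpoonup> 'a) set set" and A :: "nat \<Rightarrow> (nat \<rightharpoonup> 'a) set"
  assumes R_ideal: "R_ideal J"
    and D_suf: "D \<in> suf_J Sig t K J"
    and D_idem: "suf_prod Sig t D D = D"
    and A_in_D: "A n \<in> D n"
begin

lemma D_ultra: "ultrafilter_on (pos_tt Sig (tail_seq t n)) (D n)"
  using D_suf by (simp add: suf_J_def suf_def nonprincipal_ultrafilter_on_def)

lemma D_Int: "X \<in> D n \<Longrightarrow> Y \<in> D n \<Longrightarrow> X \<inter> Y \<in> D n"
  by (rule ultrafilter_on_Int[OF D_ultra])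

lemma D_subset: "X \<in> D n \<Longrightarrow> X \<subseteq> pos_tt Sig (tail_seq t n)"
  using D_ultra[of n] by (auto simp: ultrafilter_on_def)

lemma set_n_in_D: "X \<in> D n \<Longrightarrow> set_n Sig t n X D \<in> D n"
proof -
  assume "X \<in> D n"
  then have "X \<in> suf_prod Sig t D D n" by (simp add: D_idem)
  then show ?thesis by (simp add: suf_prod_def)
qed

text \<open>The analogue, for an idempotent ultrafilter p on a semigroup and A in p, of the set of
  those x in A for which the y with xy in A form a member of p.\<close>

definition star :: "nat \<Rightarrow> (nat \<rightharpoonup> 'a) set" where
  "star n = A n \<inter> set_n Sig t n (A n) D"

lemma star_in_D: "star n \<in> D n"
  unfolding star_def by (intro D_Int A_in_D set_n_in_D)

text \<open>As for idempotent ultrafilters on a semigroup, associativity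
  \<open>(f \<union> g) \<circledast> A = g \<circledast> (f \<circledast> A)\<close> makes \<open>star\<close> closed under one more extension.\<close>

lemma circ_star_in_D:
  assumes f: "f \<in> star n" and pf: "f \<in> pos Sig (map t [n..<m])"
  shows "circ Sig t n f (star n) \<in> D m"
proof -
  let ?C = "circ Sig t n f (A n)"
  have x: "x_of Sig t n f = m" by (rule x_of_eq[OF pf])
  have "?C \<in> D m" using f x by (simp add: star_def set_n_def)
  then have "?C \<inter> set_n Sig t m ?C D \<in> D m"
    by (intro D_Int set_n_in_D)
  moreover have "circ Sig t n f (star n) = ?C \<inter> set_n Sig t m ?C D"
  proof (rule set_eqI)
    fix g
    show "g \<in> circ Sig t n f (star n) \<longleftrightarrow> g \<in> ?C \<inter> set_n Sig t m ?C D"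
    proof (cases "g \<in> pos_tt Sig (tail_seq t m)")
      case False
      then show ?thesis by (simp add: circ_def x)
    next
      case True
      then obtain p where g: "g \<in> pos Sig (map t [m..<p])" by (auto simp: pos_tt_tail)
      note fg = pos_segment_append[OF pf g]
      \<comment> \<open>Both \<open>g\<close> and \<open>f ++ g\<close> end at index
        \<open>p\<close>, so the two \<open>set_n\<close> conditions speak about the same
        ultrafilter \<open>D p\<close>.\<close>
      have xg: "x_of Sig t m g = p" "x_of Sig t n (f ++ g) = p"
        using x_of_eq g fg by auto
      have "f ++ g \<in> pos_tt Sig (tail_seq t n)"
        using fg by (auto simp: pos_tt_tail)
      \<comment> \<open>Membership in \<open>?C\<close> also demands that \<open>g ++ h\<close> be a
        possibility from \<open>m\<close> on; given this, associativity of \<open>++\<close>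
        identifies the two sets.\<close>
      moreover have "g ++ h \<in> pos_tt Sig (tail_seq t m)" if "h \<in> pos_tt Sig (tail_seq t p)" for h
        using that g pos_segment_append by (fastforce simp: pos_tt_tail)
      then have "circ Sig t n (f ++ g) (A n) = circ Sig t m g ?C"
        by (auto simp: circ_def x xg)
      ultimately show ?thesis
        using True by (auto simp: circ_def[of Sig t n f] x star_def set_n_def xg)
    qed
  qed
  ultimately show ?thesis by simp
qed

text \<open>Otherwise the complement of the displayed set is an admissible \<open>Y\<close> in
  \<open>D_fam\<close>. The complement of \<open>B\<close> is not in \<open>D n\<close>, hence not
  in \<open>D_fam\<close>, so some candidate has a base point in \<open>Y\<close> and all its
  possibilities in \<open>B\<close>; but then that point belongs to the set.\<close>

lemma block_bases_in_J_plus: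
  assumes "B \<in> D n"
  shows "{k. \<exists>ss l. chain n ss l \<and> ss \<noteq> [] \<and> pos Sig ss \<subseteq> B \<and> k \<in> base M ss} \<in> J_plus J"
    (is "?Z \<in> _")
proof (rule ccontr)
  assume "?Z \<notin> J_plus J"
  then have Y: "- ?Z \<in> J_co J" by (auto simp: J_plus_def J_co_def)
  let ?P = "pos_tt Sig (tail_seq t n)"
  have "?P - B \<notin> D n"
    using D_ultra[of n] assms unfolding ultrafilter_on_def
    by (metis Diff_disjoint)
  then have "?P - B \<notin> D_fam Sig t K J n"
    using D_suf by (auto simp: suf_J_def)
  then have "\<exists>ss\<in>Sigma_seq Sig K (tail_seq t n).
      base M ss \<inter> - ?Z \<noteq> {} \<and> (?P - B) \<inter> pos Sig ss = {}"
    using Y unfolding D_fam_def by blast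
  then obtain ss where ss: "ss \<in> Sigma_seq Sig K (tail_seq t n)"
      "base M ss \<inter> - ?Z \<noteq> {}" "(?P - B) \<inter> pos Sig ss = {}"
    by blast
  obtain l where l: "chain n ss l" using Sigma_seq_chain ss by blast
  have ne: "ss \<noteq> []" using ss by (simp add: Sigma_seq_def)
  have "pos Sig ss \<subseteq> ?P"
    using chain_pos_subset[OF l ne] by (auto simp: pos_tt_tail)
  then have "pos Sig ss \<subseteq> B" using ss by blast
  then show False using l ne ss(2) by blast
qed

text \<open>The set required of the next block after a history \<open>bs\<close> is \<open>target bs\<close>.
  A history of the game is a list of blocks, each a finite candidate paired with the
  index in \<open>t\<close> at which the next block starts.\<close>

definition start :: "(('a, 'd) creature list \<times> nat) list \<Rightarrow> nat" where
  "start bs = (if bs = [] then 0 else snd (last bs))"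

definition flat :: "(('a, 'd) creature list \<times> nat) list \<Rightarrow> ('a, 'd) creature list" where
  "flat bs = concat (map fst bs)"

text \<open>The conditions range over all earlier block indices \<open>i\<close> because the final
  inclusion concerns runs of blocks starting at any \<open>k i\<close>.\<close>

definition target :: "(('a, 'd) creature list \<times> nat) list \<Rightarrow> (nat \<rightharpoonup> 'a) set" where
  "target bs = star (start bs) \<inter> {g. \<forall>i<length bs. \<forall>f\<in>pos Sig (flat (drop i bs)).
     g \<in> circ Sig t (start (take i bs)) f (star (start (take i bs)))}"

text \<open>The norm bound \<open>length bs\<close> grows with the round, so a single positive set
  of answers serves every bound \<open>M\<close> at the end.\<close>

definition legal where
  "legal bs b k \<longleftrightarrow> chain (start bs) (fst b) (snd b) \<and> fst b \<noteq> [] \<and>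
     pos Sig (fst b) \<subseteq> target bs \<and> k \<in> base (length bs) (fst b)"

definition history where
  "history bs \<longleftrightarrow> (\<forall>i<length bs. \<exists>k. legal (take i bs) (bs ! i) k)"

lemma start_append [simp]: "start (bs @ [b]) = snd b"
  by (simp add: start_def)

lemma flat_append [simp]: "flat (bs @ bs') = flat bs @ flat bs'"
  by (simp add: flat_def)

lemma flat_Nil [simp]: "flat [] = []" and flat_single [simp]: "flat [b] = fst b"
  by (simp_all add: flat_def)

lemma history_append: "history (bs @ [b]) \<longleftrightarrow> history bs \<and> (\<exists>k. legal bs b k)"
  by (auto simp: history_def nth_append less_Suc_eq)

section \<open>Invariants of a history\<close>

lemma history_chain:
  "history bs \<Longrightarrow> i \<le> length bs \<Longrightarrow> chain (start (take i bs)) (flat (drop i bs)) (start bs)"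
  by (induction bs rule: rev_induct)
    (auto simp: history_append legal_def chain_append le_Suc_eq)

lemma flat_drop_nonempty:
  assumes "history bs" "i < length bs"
  shows "flat (drop i bs) \<noteq> []"
proof -
  have "fst (bs ! i) \<noteq> []" using assms by (auto simp: history_def legal_def)
  moreover have "bs ! i \<in> set (drop i bs)" using assms by (metis Cons_nth_drop_Suc list.set_intros(1))
  ultimately show ?thesis by (auto simp: flat_def)
qed

text \<open>Split a possibility at the last block as \<open>f0 ++ f1\<close>: \<open>target\<close>
  puts \<open>f1\<close> into \<open>circ\<close> of \<open>f0\<close> and the star set, which says
  that \<open>f0 ++ f1\<close> is in the star set. The last block alone is covered by the first
  factor of \<open>target\<close>.\<close>

lemma history_pos:
  "history bs \<Longrightarrow> i < length bs \<Longrightarrow> pos Sig (flat (drop i bs)) \<subseteq> star (start (take i bs))"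
proof (induction bs rule: rev_induct)
  case Nil
  then show ?case by simp
next
  case (snoc b bs)
  then obtain k where h: "history bs" and b: "legal bs b k" by (auto simp: history_append)
  show ?case
  proof (cases "i = length bs")
    case True
    then show ?thesis using b by (auto simp: legal_def target_def)
  next
    case False
    then have i: "i < length bs" using snoc.prems by simp
    let ?n = "start (take i bs)"
    have c: "chain ?n (flat (drop i bs)) (start bs)" and ne: "flat (drop i bs) \<noteq> []"
      using history_chain flat_drop_nonempty h i by auto
    have "pos Sig (flat (drop i bs) @ fst b) \<subseteq> star ?n"
    proof
      fix f assume "f \<in> pos Sig (flat (drop i bs) @ fst b)"
      then obtain f0 f1 where f: "f0 \<in> pos Sig (flat (drop i bs))" "f1 \<in> pos Sig (fst b)"
        "f = f0 ++ f1"
        using pos_append_split chain_dom[OF c ne] chain_dom b by (metis legal_def)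
      then have "f1 \<in> circ Sig t ?n f0 (star ?n)"
        using b i by (auto simp: legal_def target_def)
      then show "f \<in> star ?n" using f by (simp add: circ_def)
    qed
    then show ?thesis using i by simp
  qed
qed

text \<open>A finite intersection of large sets: each earlier possibility \<open>f\<close> ends at
  index \<open>start bs\<close> and lies in its star set by \<open>history_pos\<close>, so
  \<open>circ_star_in_D\<close> applies.\<close>

lemma target_in_D:
  assumes h: "history bs"
  shows "target bs \<in> D (start bs)"
proof -
  let ?I = "SIGMA i:{..<length bs}. pos Sig (flat (drop i bs))"
  let ?F = "\<lambda>(i, f). circ Sig t (start (take i bs)) f (star (start (take i bs)))"
  have "?F p \<in> D (start bs)" if in_I: "p \<in> ?I" for p
  proof -
    obtain i f where p: "p = (i, f)" "i < length bs" "f \<in> pos Sig (flat (drop i bs))"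
      using in_I by (cases p) auto
    have "f \<in> pos Sig (map t [start (take i bs)..<start bs])"
      using chain_pos_subset[OF history_chain[OF h] flat_drop_nonempty[OF h]] p by auto
    moreover have "f \<in> star (start (take i bs))"
      using history_pos[OF h] p by blast
    ultimately show ?thesis using circ_star_in_D p by simp
  qed
  then have "star (start bs) \<inter> (pos_tt Sig (tail_seq t (start bs)) \<inter> (\<Inter>p\<in>?I. ?F p)) \<in> D (start bs)"
    using finite_pos by (intro D_Int[OF star_in_D] ultrafilter_on_INT[OF D_ultra] finite_SigmaI) auto
  moreover have "target bs =
      star (start bs) \<inter> (pos_tt Sig (tail_seq t (start bs)) \<inter> (\<Inter>p\<in>?I. ?F p))"
    using D_subset[OF star_in_D] by (auto simp: target_def)
  ultimately show ?thesis by simp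
qed

lemma winning_play:
  obtains b k where "\<And>i. legal (map b [0..<i]) (b i) (k i)" "range k \<in> J_plus J"
proof (rule R_ideal_play[OF R_ideal])
  fix bs
  assume "\<forall>i<length bs. \<exists>k. legal (take i bs) (bs ! i) k"
  then have "history bs" by (simp add: history_def)
  from block_bases_in_J_plus[OF target_in_D[OF this]]
  show "{k. \<exists>b. legal bs b k} \<in> J_plus J" by (simp add: legal_def)
qed (rule that)

section \<open>Assembling the blocks into an infinite candidate\<close>

lemma cand_le_segments:
  assumes "\<And>n. \<exists>a b. s n \<in> Sig (map t [a..<b])" and link: "\<And>n. mup (s n) = mdn (s (Suc n))"
  shows "cand_le Sig t s"
proof -
  obtain a b where s: "\<And>n. s n \<in> Sig (map t [a n..<b n])"
    using assms(1) by metis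
  \<comment> \<open>Injectivity of \<open>mdn\<close> along \<open>t\<close> turns the links between
    creatures into adjacency of index intervals, which then serve as the sets
    \<open>u n\<close>.\<close>
  have b: "b n = a (Suc n)" for n
    using link[of n] segment_mup[OF s] segment_mdn[OF s] by simp
  show ?thesis
    unfolding cand_le_def
  proof (intro exI allI conjI)
    fix n
    have lt: "a n < b n" "a (Suc n) < b (Suc n)" using segment_lt[OF s] by auto
    show "finite {a n..<b n}" "{a n..<b n} \<noteq> {}" using lt by auto
    have "Max {a n..<b n} < b n" using lt by simp
    also have "b n \<le> Min {a (Suc n)..<b (Suc n)}" using lt(2) unfolding b[of n] by simp
    finally show "Max {a n..<b n} < Min {a (Suc n)..<b (Suc n)}" by simp
    show "s n \<in> Sig (map t (sorted_list_of_set {a n..<b n}))"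
      using s by simp
  qed
qed

lemma ex_homogeneous_candidate:
  "\<exists>s (k :: nat \<Rightarrow> nat). s \<in> PC_winf J K \<and> k 0 = 0 \<and> strict_mono k \<and>
     cand_le Sig t s \<and> mdn (s 0) = mdn (t 0) \<and>
     (\<forall>i j l. i < j \<longrightarrow> s (k i) \<in> Sigma_tt Sig (tail_seq t l) \<longrightarrow>
        pos Sig (map s [k i..<k j]) \<subseteq> A l)"
proof -
  obtain b z where b: "\<And>i. legal (map b [0..<i]) (b i) (z i)" and z: "range z \<in> J_plus J"
    by (rule winning_play) blast
  have hist: "history (map b [0..<i])" for i
    by (induction i) (use b in \<open>auto simp: history_append\<close>, simp add: history_def)
  define c where "c i = flat (map b [0..<i])" for i
  define k where "k i = length (c i)" for i
  \<comment> \<open>Blocks are non-empty, so \<open>c (Suc n)\<close> has more than \<open>n\<close>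
    entries; each later \<open>c i\<close> extends it and has the same entry at
    \<open>n\<close>.\<close>
  define s where "s n = c (Suc n) ! n" for n
  have c_Suc: "c (Suc i) = c i @ fst (b i)" for i
    by (simp add: c_def)
  have c_split: "c j = c i @ flat (map b [i..<j])" if "i \<le> j" for i j
  proof -
    have "map b [0..<j] = map b [0..<i] @ map b [i..<j]"
      using that by (simp add: map_upt_append)
    then show ?thesis by (simp add: c_def)
  qed
  have "fst (b i) \<noteq> []" for i using b by (simp add: legal_def)
  then have k: "strict_mono k"
    by (simp add: strict_mono_Suc_iff k_def c_Suc)
  have lt_k: "n < k (Suc n)" for n
    using strict_mono_imp_increasing[OF k, of "Suc n"] by simp
  have s_nth: "s n = c i ! n" if "n < k i" for n i
  proof (cases "i \<le> Suc n")
    case True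
    show ?thesis
      using that unfolding s_def c_split[OF True] by (simp add: k_def nth_append)
  next
    case False
    then have "Suc n \<le> i" by simp
    from c_split[OF this] show ?thesis
      using lt_k[of n] by (simp add: s_def k_def nth_append)
  qed
  have map_s: "map s [k i..<k j] = flat (map b [i..<j])" if "i \<le> j" for i j
    using c_split[OF that] s_nth[of _ j]
    by (intro nth_equalityI) (auto simp: k_def nth_append)
  have chain: "chain (start (map b [0..<i])) (flat (map b [i..<j])) (start (map b [0..<j]))"
    if "i \<le> j" for i j
    using history_chain[OF hist[of j], of i] that by (simp add: take_map drop_map)
  have pos: "pos Sig (flat (map b [i..<j])) \<subseteq> star (start (map b [0..<i]))" if "i < j" for i j
    using history_pos[OF hist[of j], of i] that by (simp add: take_map drop_map)
  have c_chain: "chain 0 (c i) (start (map b [0..<i]))" for i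
    using chain[of 0 i] by (simp add: c_def start_def)
  have s_seg: "\<exists>a b. s n \<in> Sig (map t [a..<b])" for n
    using chain_in_segments[OF c_chain[of "Suc n"], of "s n"] lt_k[of n] by (simp add: s_def k_def)
  have s_K: "s n \<in> K" for n
    using s_seg dom_SigmaI Sig_subset by blast
  have s_link: "mup (s n) = mdn (s (Suc n))" for n
  proof -
    have "successively (\<lambda>s s'. mup s = mdn s') (c (Suc (Suc n)))"
      using chain_finite_candidate[OF c_chain] by (simp add: finite_candidate_def)
    then show ?thesis
      using s_nth[of n "Suc (Suc n)"] s_nth[of "Suc n" "Suc (Suc n)"] lt_k[of "Suc n"]
      by (simp add: successively_conv_nth k_def)
  qed
  have s_k: "mdn (s (k i)) = mdn (t (start (map b [0..<i])))" for i
  proof -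
    have "k i < k (Suc i)" using k by (simp add: strict_mono_Suc_iff)
    then have "map s [k i..<k (Suc i)] \<noteq> []" "hd (map s [k i..<k (Suc i)]) = s (k i)"
      by (auto simp: hd_map)
    then show ?thesis
      using map_s[of i "Suc i"] chain_mdn_hd[OF chain[of i "Suc i"]] by simp
  qed
  have J: "ideal_on_nat J" using R_ideal by (simp add: R_ideal_def)
  have k0: "k 0 = 0" by (simp add: k_def c_def)
  have "{mdn (s n) | n. nor (s n) > real M} \<in> J_plus J" for M
  proof -
    \<comment> \<open>Strictly \<open>i > M\<close>, because \<open>PC_winf\<close> asks for norm
      above \<open>M\<close> while round \<open>i\<close> guarantees only norm at least
      \<open>i\<close>.\<close>
    have "z i \<in> {mdn (s n) | n. nor (s n) > real M}" if "i > M" for i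
    proof -
      obtain r where r: "r \<in> set (fst (b i))" "z i = mdn r" "nor r \<ge> real i"
        using b[of i] by (auto simp: legal_def base_def)
      have "fst (b i) = map s [k i..<k (Suc i)]"
        using map_s[of i "Suc i"] by simp
      then obtain n where "r = s n" using r(1) by auto
      then show ?thesis using r(2,3) that by auto
    qed
    \<comment> \<open>Only the answers of rounds up to \<open>M\<close> can fall outside; they form
      a finite set, which lies in the ideal.\<close>
    then have "range z \<subseteq> z ` {..M} \<union> {mdn (s n) | n. nor (s n) > real M}" 
      (is "_ \<subseteq> ?E \<union> ?B")
      by (meson UnCI atMost_iff image_eqI image_subsetI not_le)
    moreover have "?E \<in> J" using ideal_on_nat_finite J by simp
    ultimately have "?B \<notin> J"
      using ideal_on_nat_Un[OF J, of ?E ?B] ideal_on_nat_subset[OF J] z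
      by (auto simp only: J_plus_def Compl_iff)
    then show ?thesis by (simp add: J_plus_def)
  qed
  then have "s \<in> PC_winf J K" using s_K s_link by (simp add: PC_winf_def)
  moreover have "cand_le Sig t s" using s_seg s_link by (rule cand_le_segments)
  moreover have "mdn (s 0) = mdn (t 0)" using s_k[of 0] k0 by (simp add: start_def)
  moreover have "pos Sig (map s [k i..<k j]) \<subseteq> A l"
    if "i < j" and s_in: "s (k i) \<in> Sigma_tt Sig (tail_seq t l)" for i j l
  proof -
    obtain m where "s (k i) \<in> Sig (map t [l + 0..<l + Suc m])"
      using s_in unfolding Sigma_tt_def map_tail_seq by blast
    \<comment> \<open>Creatures in \<open>Sigma_tt\<close> of the tail at \<open>l\<close> start at
      \<open>mdn (t l)\<close>, so \<open>l\<close> can only be the starting index of block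
      \<open>i\<close>.\<close>
    then have "start (map b [0..<i]) = l"
      using segment_mdn s_k[of i] by fastforce
    then show ?thesis
      using pos[OF that(1)] map_s[of i j] that(1) by (auto simp: star_def)
  qed
  ultimately show ?thesis
    using k k0 by (intro exI[of _ s] exI[of _ k]) simp
qed

end

theorem theorem5p12:
  fixes H :: "nat \<Rightarrow> 'a set"
    and K :: "('a, 'd) creature set"
    and Sig :: "('a, 'd) creature list \<Rightarrow> ('a, 'd) creature set"
    and J :: "nat set set"
    and t :: "nat \<Rightarrow> ('a, 'd) creature"
    and D :: "nat \<Rightarrow> (nat \<rightharpoonup> 'a) set set"
    and A :: "nat \<Rightarrow> (nat \<rightharpoonup> 'a) set"
  assumes "tight_FFCC_pair H K Sig"
    and "R_ideal J"
    and "t \<in> PC_winf J K"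
    and "D \<in> suf_J Sig t K J"
    and "suf_prod Sig t D D = D"
    and "\<And>n. A n \<in> D n"
  shows "\<exists>(s :: nat \<Rightarrow> ('a, 'd) creature) (k :: nat \<Rightarrow> nat).
           s \<in> PC_winf J K \<and> k 0 = 0 \<and> strict_mono k \<and>
           cand_le Sig t s \<and> mdn (s 0) = mdn (t 0) \<and>
           (\<forall>i j l. i < j \<longrightarrow> s (k i) \<in> Sigma_tt Sig (tail_seq t l) \<longrightarrow>
              pos Sig (map s [k i..<k j]) \<subseteq> A l)"
proof -
  interpret tight_FFCC_pair H K Sig by fact
  interpret FFCC_idempotent H K Sig t J D A
    using assms by unfold_locales (auto simp: PC_winf_def)
  show ?thesis by (rule ex_homogeneous_candidate)
qed

end
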